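(* For fixed $n=\mathrm{rank}\,H$ and $r=\mathrm{rank}\,K$ such that the strict inequality $\binom{n-r+1}{2}>r$ holds, the nonregular symbols constitute a generic subset in the set of all CR symbols (of $2$-nondegenerate, hypersurface-type CR structures $H$ with Levi kernel $K$ of these ranks).
   Context: CR structures. All objects are real-analytic. A CR structure of hypersurface type on a $(2n+1)$-dimensional real manifold $M$ is a complex rank $n$ subbundle $H\subset\mathbb CTM$ with $[H,H]\subset H$, $H\cap\overline H=0$. $K$ is the kernel of the Levi form $\mathcal L(X_p,Y_p)=\frac i2[X,\overline Y]_p\bmod H_p\oplus\overline H_p$, assumed of constant rank $r$; the reduced Levi form is the nondegenerate Hermitian form $\ell$ induced by $\mathcal L$ on $H_p/K_p$ (defined up to real scale). For $v\in K_p$, $\mathrm{ad}_v:\overline H_p/\overline K_p\to H_p/K_p$ is $y\mapsto[V,Y]_p\bmod K_p\oplus\overline H_p$ ($V\in\Gamma(K)$, $Y\in\Gamma(\overline H)$ extending $v,y$). $2$-nondegenerate: $K\ne0$ and $\mathrm{ad}_v\ne0$ for all $0\neq v\in K_p$ and all $p$. CR symbols. A CR symbol is given by: a $2(n-r)$-dimensional complex conformal symplectic space $\mathfrak g_{-1}$ with antilinear involution $\sigma$; a splitting $\mathfrak g_{-1}=\mathfrak g_{-1,-1}\oplus\mathfrak g_{-1,1}$ into Lagrangian subspaces interchanged by $\sigma$; and $r$-dimensional subspaces $\mathfrak g_{0,\pm2}\subset\mathfrak{csp}(\mathfrak g_{-1})$, whose elements map $\mathfrak g_{-1,\mp1}$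 to $\mathfrak g_{-1,\pm1}$ and vanish on $\mathfrak g_{-1,\pm1}$, interchanged by $\varphi\mapsto\sigma\varphi\sigma$ (for a CR structure at $p$: $\mathfrak g_{-1,1}=H_p/K_p$, $\mathfrak g_{-1,-1}=\overline H_p/\overline K_p$, conformal symplectic form induced by the Levi form, $\mathfrak g_{0,2}=\{\mathrm{ad}_v:v\in K_p\}$). Let $\mathfrak g_{0,0}$ be the maximal subalgebra of $\mathfrak{csp}(\mathfrak g_{-1})$ preserving $\mathfrak g_{-1,\pm1}$ and with $[\mathfrak g_{0,0},\mathfrak g_{0,\pm2}]\subset\mathfrak g_{0,\pm2}$. The symbol is regular if $[\mathfrak g_{0,-2},\mathfrak g_{0,2}]\subset\mathfrak g_{0,0}$, and nonregular otherwise. Genericity. Put $m=n-r$. In a basis of $\mathfrak g_{-1,1}$ where $\ell$ is represented by the invertible Hermitian matrix $H_\ell$, and the conjugate basis of $\mathfrak g_{-1,-1}$, $\mathfrak g_{0,2}$ is represented by the span of linearly independent $m\times m$ matrices $C_1,\dots,C_r$ with $C_iH_\ell^{-1}$ symmetric, and $\mathfrak g_{0,-2}$ by the span of $\overline{C_1},\dots,\overline{C_r}$. For fixed $n$, $r$ and signature of $\ell$ (with $H_\ell$ fixed), CR symbols are parametrized by $r$-tuples $(C_1,\dots,C_r)$ of linearly independent matrices with $C_iH_\ell^{-1}$ symmetric. A set of CR symbols is generic if, for each fixed signature, it contains all symbols given by tuples outside some proper real-algebraic subset of this parameter space. *)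

theory Defs
  imports "HOL-Analysis.Analysis" "HOL-Library.Function_Algebras"
begin

(* Complex vector spaces are given by a scaling sc :: complex => 'v => 'v with
   vector_space sc. The full function space 'v => 'v then carries pointwise scaling. *)
definition fun_scale :: "(complex \<Rightarrow> 'v \<Rightarrow> 'v) \<Rightarrow> complex \<Rightarrow> ('v \<Rightarrow> 'v) \<Rightarrow> ('v \<Rightarrow> 'v)" where
  "fun_scale sc c f = (\<lambda>x. sc c (f x))"

lemma vector_space_fun_scale:
  fixes sc :: "complex \<Rightarrow> 'v::ab_group_add \<Rightarrow> 'v"
  assumes "vector_space sc"
  shows "vector_space (fun_scale sc)"
proof -
  interpret vector_space sc by fact
  show ?thesis
    by unfold_locales (auto simp: fun_scale_def fun_eq_iff scale_right_distrib scale_left_distrib)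
qed

definition lie_bracket :: "('v::ab_group_add \<Rightarrow> 'v) \<Rightarrow> ('v \<Rightarrow> 'v) \<Rightarrow> ('v \<Rightarrow> 'v)" where
  "lie_bracket \<phi> \<psi> = (\<lambda>x. \<phi> (\<psi> x) - \<psi> (\<phi> x))"

definition symplectic_form ::
  "(complex \<Rightarrow> 'v::ab_group_add \<Rightarrow> 'v) \<Rightarrow> ('v \<Rightarrow> 'v \<Rightarrow> complex) \<Rightarrow> bool" where
  "symplectic_form sc \<omega> \<longleftrightarrow>
     (\<forall>x. Vector_Spaces.linear sc (*) (\<omega> x)) \<and>
     (\<forall>y. Vector_Spaces.linear sc (*) (\<lambda>x. \<omega> x y)) \<and>
     (\<forall>x. \<omega> x x = 0) \<and>
     (\<forall>x. (\<forall>y. \<omega> x y = 0) \<longrightarrow> x = 0)"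

definition conformal_symplectic ::
  "(complex \<Rightarrow> 'v::ab_group_add \<Rightarrow> 'v) \<Rightarrow> ('v \<Rightarrow> 'v \<Rightarrow> complex) set \<Rightarrow> bool" where
  "conformal_symplectic sc \<Omega> \<longleftrightarrow>
     (\<exists>\<omega>. symplectic_form sc \<omega> \<and> \<Omega> = {\<lambda>x y. c * \<omega> x y | c. c \<noteq> 0})"

definition csp ::
  "(complex \<Rightarrow> 'v::ab_group_add \<Rightarrow> 'v) \<Rightarrow> ('v \<Rightarrow> 'v \<Rightarrow> complex) set \<Rightarrow> ('v \<Rightarrow> 'v) set" where
  "csp sc \<Omega> = {\<phi>. Vector_Spaces.linear sc sc \<phi> \<and>
     (\<forall>\<omega>\<in>\<Omega>. \<exists>c. \<forall>x y. \<omega> (\<phi> x) y + \<omega> x (\<phi> y) = c * \<omega> x y)}"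

definition lagrangian :: "('v \<Rightarrow> 'v \<Rightarrow> complex) set \<Rightarrow> 'v set \<Rightarrow> bool" where
  "lagrangian \<Omega> L \<longleftrightarrow> (\<forall>\<omega>\<in>\<Omega>. L = {x. \<forall>y\<in>L. \<omega> x y = 0})"

definition antilinear_involution ::
  "(complex \<Rightarrow> 'v::ab_group_add \<Rightarrow> 'v) \<Rightarrow> ('v \<Rightarrow> 'v) \<Rightarrow> bool" where
  "antilinear_involution sc \<sigma> \<longleftrightarrow>
     (\<forall>x y. \<sigma> (x + y) = \<sigma> x + \<sigma> y) \<and> (\<forall>c x. \<sigma> (sc c x) = sc (cnj c) (\<sigma> x)) \<and>
     (\<forall>x. \<sigma> (\<sigma> x) = x)"

(* The type 'v is the whole space g_{-1}; the suffix m stands for a minus sign: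
   gm_p = g_{-1,1}, gm_m = g_{-1,-1}, g0_p = g_{0,2}, g0_m = g_{0,-2}. *)
record 'v cr_symbol =
  scl :: "complex \<Rightarrow> 'v \<Rightarrow> 'v"
  forms :: "('v \<Rightarrow> 'v \<Rightarrow> complex) set"
  invol :: "'v \<Rightarrow> 'v"
  gm_m :: "'v set"
  gm_p :: "'v set"
  g0_m :: "('v \<Rightarrow> 'v) set"
  g0_p :: "('v \<Rightarrow> 'v) set"

(* The forms in the conformal class that are compatible with conjugation. The bracket
   omega(X,Y) = [X,Y] modulo H and its conjugate is one of them, and they are all
   its nonzero real multiples. *)
definition real_forms :: "'v cr_symbol \<Rightarrow> ('v \<Rightarrow> 'v \<Rightarrow> complex) set" where
  "real_forms s = {\<omega> \<in> forms s. \<forall>x y. \<omega> (invol s x) (invol s y) = cnj (\<omega> x y)}"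

(* 2-nondegeneracy forces 0 < r (as K is nonzero) and r < n (as ad_v is nonzero).
   Since then both dimensions below are positive, they are genuine finite dimensions
   and not the value 0 that dim takes on infinite-dimensional spaces. *)
definition CR_symbols :: "nat \<Rightarrow> nat \<Rightarrow> 'v::ab_group_add cr_symbol set" where
  "CR_symbols n r = {s. 0 < r \<and> r < n \<and>
     vector_space (scl s) \<and> vector_space.dim (scl s) (UNIV :: 'v set) = 2 * (n - r) \<and>
     conformal_symplectic (scl s) (forms s) \<and>
     antilinear_involution (scl s) (invol s) \<and> real_forms s \<noteq> {} \<and>
     module.subspace (scl s) (gm_m s) \<and> module.subspace (scl s) (gm_p s) \<and>
     gm_m s \<inter> gm_p s = {0} \<and> (\<forall>x. \<exists>y\<in>gm_m s. \<exists>z\<in>gm_p s. x = y + z) \<and>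
     lagrangian (forms s) (gm_m s) \<and> lagrangian (forms s) (gm_p s) \<and>
     invol s ` gm_m s = gm_p s \<and> invol s ` gm_p s = gm_m s \<and>
     g0_m s \<subseteq> csp (scl s) (forms s) \<and> g0_p s \<subseteq> csp (scl s) (forms s) \<and>
     module.subspace (fun_scale (scl s)) (g0_m s) \<and>
     module.subspace (fun_scale (scl s)) (g0_p s) \<and>
     vector_space.dim (fun_scale (scl s)) (g0_m s) = r \<and>
     vector_space.dim (fun_scale (scl s)) (g0_p s) = r \<and>
     (\<forall>\<phi>\<in>g0_p s. \<phi> ` gm_m s \<subseteq> gm_p s \<and> (\<forall>x\<in>gm_p s. \<phi> x = 0)) \<and>
     (\<forall>\<phi>\<in>g0_m s. \<phi> ` gm_p s \<subseteq> gm_m s \<and> (\<forall>x\<in>gm_m s. \<phi> x = 0)) \<and>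
     (\<lambda>\<phi>. invol s \<circ> \<phi> \<circ> invol s) ` g0_p s = g0_m s \<and>
     (\<lambda>\<phi>. invol s \<circ> \<phi> \<circ> invol s) ` g0_m s = g0_p s}"

definition admissible_subalgebra ::
  "'v::ab_group_add cr_symbol \<Rightarrow> ('v \<Rightarrow> 'v) set \<Rightarrow> bool" where
  "admissible_subalgebra s A \<longleftrightarrow>
     A \<subseteq> csp (scl s) (forms s) \<and> module.subspace (fun_scale (scl s)) A \<and>
     (\<forall>\<phi>\<in>A. \<forall>\<psi>\<in>A. lie_bracket \<phi> \<psi> \<in> A) \<and>
     (\<forall>\<phi>\<in>A. \<phi> ` gm_m s \<subseteq> gm_m s \<and> \<phi> ` gm_p s \<subseteq> gm_p s) \<and>
     (\<forall>\<phi>\<in>A. \<forall>\<psi>\<in>g0_m s. lie_bracket \<phi> \<psi> \<in> g0_m s) \<and>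
     (\<forall>\<phi>\<in>A. \<forall>\<psi>\<in>g0_p s. lie_bracket \<phi> \<psi> \<in> g0_p s)"

(* The largest admissible subalgebra g_{0,0}; that the set of all elements satisfying the
   conditions is itself a subalgebra is g00_admissible below. *)
definition g00 :: "'v::ab_group_add cr_symbol \<Rightarrow> ('v \<Rightarrow> 'v) set" where
  "g00 s = {\<phi> \<in> csp (scl s) (forms s).
     \<phi> ` gm_m s \<subseteq> gm_m s \<and> \<phi> ` gm_p s \<subseteq> gm_p s \<and>
     (\<forall>\<psi>\<in>g0_m s. lie_bracket \<phi> \<psi> \<in> g0_m s) \<and>
     (\<forall>\<psi>\<in>g0_p s. lie_bracket \<phi> \<psi> \<in> g0_p s)}"

lemma g00_greatest: "admissible_subalgebra s A \<Longrightarrow> A \<subseteq> g00 s"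
  unfolding admissible_subalgebra_def g00_def by blast

lemma g00_admissible:
  fixes s :: "'v::ab_group_add cr_symbol"
  assumes "s \<in> CR_symbols n r"
  shows "admissible_subalgebra s (g00 s)"
proof -
  have vs: "vector_space (scl s)" and cf: "conformal_symplectic (scl s) (forms s)"
    and gm: "module.subspace (scl s) (gm_m s)" "module.subspace (scl s) (gm_p s)"
    and g0': "module.subspace (fun_scale (scl s)) (g0_m s)"
      "module.subspace (fun_scale (scl s)) (g0_p s)"
    and g0c: "g0_m s \<subseteq> csp (scl s) (forms s)" "g0_p s \<subseteq> csp (scl s) (forms s)"
    using assms by (auto simp: CR_symbols_def)
  interpret V: vector_space "scl s" by fact
  interpret F: vector_space "fun_scale (scl s)" by (rule vector_space_fun_scale[OF vs])
  interpret VV: vector_space_pair "scl s" "scl s" ..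
  interpret VC: vector_space_pair "scl s" "(*) :: complex \<Rightarrow> complex \<Rightarrow> complex"
    by unfold_locales (auto simp: algebra_simps)
  note g0 = g0'[unfolded F.subspace_def]
  have omega: "\<omega> (x + y) z = \<omega> x z + \<omega> y z" "\<omega> (x - y) z = \<omega> x z - \<omega> y z"
    "\<omega> z (x + y) = \<omega> z x + \<omega> z y" "\<omega> z (x - y) = \<omega> z x - \<omega> z y"
    "\<omega> (scl s c x) z = c * \<omega> x z" "\<omega> z (scl s c x) = c * \<omega> z x"
    "\<omega> 0 z = 0" "\<omega> z 0 = 0"
    if "\<omega> \<in> forms s" for \<omega> x y z c
  proof -
    obtain \<omega>0 k where w0: "symplectic_form (scl s) \<omega>0" and k: "\<omega> = (\<lambda>x y. k * \<omega>0 x y)"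
      using cf \<open>\<omega> \<in> forms s\<close> unfolding conformal_symplectic_def by blast
    have l: "Vector_Spaces.linear (scl s) (*) (\<omega>0 z)" "Vector_Spaces.linear (scl s) (*) (\<lambda>x. \<omega>0 x z)"
      for z using w0 by (auto simp: symplectic_form_def)
    note * = VC.linear_add[OF l(1)] VC.linear_diff[OF l(1)] VC.linear_scale[OF l(1)] VC.linear_0[OF l(1)]
      VC.linear_add[OF l(2)] VC.linear_diff[OF l(2)] VC.linear_scale[OF l(2)] VC.linear_0[OF l(2)]
    show "\<omega> (x + y) z = \<omega> x z + \<omega> y z" "\<omega> (x - y) z = \<omega> x z - \<omega> y z"
      "\<omega> z (x + y) = \<omega> z x + \<omega> z y" "\<omega> z (x - y) = \<omega> z x - \<omega> z y"
      "\<omega> (scl s c x) z = c * \<omega> x z" "\<omega> z (scl s c x) = c * \<omega> z x"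
      "\<omega> 0 z = 0" "\<omega> z 0 = 0"
      by (simp_all add: k * algebra_simps)
  qed
  have lin: "Vector_Spaces.linear (scl s) (scl s) \<phi>" if "\<phi> \<in> csp (scl s) (forms s)" for \<phi>
    using that by (simp add: csp_def)
  note lins = VV.linear_add[OF lin] VV.linear_diff[OF lin] VV.linear_scale[OF lin] VV.linear_0[OF lin]
  have linI: "Vector_Spaces.linear (scl s) (scl s) f"
    if "\<And>x y. f (x + y) = f x + f y" "\<And>c x. f (scl s c x) = scl s c (f x)" for f
    using that by (simp add: Vector_Spaces.linear_iff vs)
  have csp0: "0 \<in> csp (scl s) (forms s)"
    by (auto simp: csp_def omega intro!: linI exI[of _ 0])
  have csp_add: "\<phi> + \<psi> \<in> csp (scl s) (forms s)"
    if p: "\<phi> \<in> csp (scl s) (forms s)" "\<psi> \<in> csp (scl s) (forms s)" for \<phi> \<psi>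
  proof -
    have "\<exists>c. \<forall>x y. \<omega> ((\<phi> + \<psi>) x) y + \<omega> x ((\<phi> + \<psi>) y) = c * \<omega> x y" if w: "\<omega> \<in> forms s" for \<omega>
    proof -
      obtain c d where "\<forall>x y. \<omega> (\<phi> x) y + \<omega> x (\<phi> y) = c * \<omega> x y"
        "\<forall>x y. \<omega> (\<psi> x) y + \<omega> x (\<psi> y) = d * \<omega> x y" using p w unfolding csp_def by blast
      then have 1: "\<omega> (\<phi> x) y = c * \<omega> x y - \<omega> x (\<phi> y)"
        and 2: "\<omega> (\<psi> x) y = d * \<omega> x y - \<omega> x (\<psi> y)" for x y
        by (simp_all add: eq_diff_eq)
      have "\<forall>x y. \<omega> ((\<phi> + \<psi>) x) y + \<omega> x ((\<phi> + \<psi>) y) = (c + d) * \<omega> x y"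
        by (simp add: omega[OF w] 1 2 algebra_simps)
      then show ?thesis ..
    qed
    then show ?thesis using p
      by (auto simp: csp_def lins V.scale_right_distrib intro!: linI)
  qed
  have csp_scale: "fun_scale (scl s) a \<phi> \<in> csp (scl s) (forms s)"
    if p: "\<phi> \<in> csp (scl s) (forms s)" for \<phi> a
  proof -
    have "\<exists>c. \<forall>x y. \<omega> (fun_scale (scl s) a \<phi> x) y + \<omega> x (fun_scale (scl s) a \<phi> y) = c * \<omega> x y"
      if w: "\<omega> \<in> forms s" for \<omega>
    proof -
      obtain c where "\<forall>x y. \<omega> (\<phi> x) y + \<omega> x (\<phi> y) = c * \<omega> x y"
        using p w unfolding csp_def by blast
      then have "\<forall>x y. \<omega> (fun_scale (scl s) a \<phi> x) y + \<omega> x (fun_scale (scl s) a \<phi> y) = (a * c) * \<omega> x y"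
        by (simp add: omega[OF w] fun_scale_def flip: distrib_left)
      then show ?thesis ..
    qed
    then show ?thesis using p
      by (auto simp: csp_def fun_scale_def lins V.scale_right_distrib V.scale_left_commute intro!: linI)
  qed
  have csp_lie: "lie_bracket \<phi> \<psi> \<in> csp (scl s) (forms s)"
    if p: "\<phi> \<in> csp (scl s) (forms s)" "\<psi> \<in> csp (scl s) (forms s)" for \<phi> \<psi>
  proof -
    have "\<exists>c. \<forall>x y. \<omega> (lie_bracket \<phi> \<psi> x) y + \<omega> x (lie_bracket \<phi> \<psi> y) = c * \<omega> x y"
      if w: "\<omega> \<in> forms s" for \<omega>
    proof -
      obtain c d where "\<forall>x y. \<omega> (\<phi> x) y + \<omega> x (\<phi> y) = c * \<omega> x y"
        "\<forall>x y. \<omega> (\<psi> x) y + \<omega> x (\<psi> y) = d * \<omega> x y" using p w unfolding csp_def by blast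
      then have 1: "\<omega> (\<phi> x) y = c * \<omega> x y - \<omega> x (\<phi> y)" 
        and 2: "\<omega> (\<psi> x) y = d * \<omega> x y - \<omega> x (\<psi> y)" for x y
        by (simp_all add: eq_diff_eq)
      have "\<forall>x y. \<omega> (lie_bracket \<phi> \<psi> x) y + \<omega> x (lie_bracket \<phi> \<psi> y) = 0 * \<omega> x y"
        by (simp add: omega[OF w] lie_bracket_def 1 2 algebra_simps)
      then show ?thesis ..
    qed
    then show ?thesis using p
      by (auto simp: csp_def lie_bracket_def lins V.scale_right_diff_distrib algebra_simps
          VV.linear_add VV.linear_scale intro!: linI)
  qed
  have b0: "lie_bracket 0 \<psi> = 0" if "\<psi> \<in> csp (scl s) (forms s)" for \<psi>
    using that by (auto simp: lie_bracket_def fun_eq_iff lins)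
  have badd: "lie_bracket (\<phi>1 + \<phi>2) \<psi> = lie_bracket \<phi>1 \<psi> + lie_bracket \<phi>2 \<psi>"
    if "\<psi> \<in> csp (scl s) (forms s)" for \<phi>1 \<phi>2 \<psi>
    using that by (auto simp: lie_bracket_def fun_eq_iff lins)
  have bsc: "lie_bracket (fun_scale (scl s) a \<phi>) \<psi> = fun_scale (scl s) a (lie_bracket \<phi> \<psi>)"
    if "\<psi> \<in> csp (scl s) (forms s)" for a \<phi> \<psi>
    using that by (auto simp: lie_bracket_def fun_scale_def fun_eq_iff lins V.scale_right_diff_distrib)
  have jac: "lie_bracket (lie_bracket \<phi> \<psi>) \<xi>
      = lie_bracket \<phi> (lie_bracket \<psi> \<xi>) + fun_scale (scl s) (-1) (lie_bracket \<psi> (lie_bracket \<phi> \<xi>))"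
    if "\<phi> \<in> csp (scl s) (forms s)" "\<psi> \<in> csp (scl s) (forms s)" "\<xi> \<in> csp (scl s) (forms s)" for \<phi> \<psi> \<xi>
    using that by (auto simp: lie_bracket_def fun_scale_def fun_eq_iff lins)
  have g00I: "\<phi> \<in> g00 s" if "\<phi> \<in> csp (scl s) (forms s)"
    "\<And>x. x \<in> gm_m s \<Longrightarrow> \<phi> x \<in> gm_m s" "\<And>x. x \<in> gm_p s \<Longrightarrow> \<phi> x \<in> gm_p s"
    "\<And>\<psi>. \<psi> \<in> g0_m s \<Longrightarrow> lie_bracket \<phi> \<psi> \<in> g0_m s"
    "\<And>\<psi>. \<psi> \<in> g0_p s \<Longrightarrow> lie_bracket \<phi> \<psi> \<in> g0_p s" for \<phi>
    using that unfolding g00_def by blast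
  have g00D: "\<phi> \<in> csp (scl s) (forms s)"
    "x \<in> gm_m s \<Longrightarrow> \<phi> x \<in> gm_m s" "x \<in> gm_p s \<Longrightarrow> \<phi> x \<in> gm_p s"
    "\<psi> \<in> g0_m s \<Longrightarrow> lie_bracket \<phi> \<psi> \<in> g0_m s"
    "\<psi> \<in> g0_p s \<Longrightarrow> lie_bracket \<phi> \<psi> \<in> g0_p s" if "\<phi> \<in> g00 s" for \<phi> \<psi> x
    using that unfolding g00_def by blast+
  have sub: "module.subspace (fun_scale (scl s)) (g00 s)"
  proof (rule F.subspaceI)
    show "0 \<in> g00 s"
      using g0 g0c csp0 V.subspace_0[OF gm(1)] V.subspace_0[OF gm(2)]
      by (auto simp: g00_def b0 subset_iff)
  next
    fix \<phi> \<psi> assume p: "\<phi> \<in> g00 s" "\<psi> \<in> g00 s"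
    show "\<phi> + \<psi> \<in> g00 s"
    proof (rule g00I)
      show "\<phi> + \<psi> \<in> csp (scl s) (forms s)" using p by (intro csp_add g00D)
    qed (use p g0c in \<open>auto simp: badd subset_iff
          intro!: V.subspace_add[OF gm(1)] V.subspace_add[OF gm(2)]
            F.subspace_add[OF g0'(1)] F.subspace_add[OF g0'(2)] dest: g00D\<close>)
  next
    fix a \<phi> assume p: "\<phi> \<in> g00 s"
    show "fun_scale (scl s) a \<phi> \<in> g00 s"
    proof (rule g00I)
      show "fun_scale (scl s) a \<phi> \<in> csp (scl s) (forms s)" using p by (intro csp_scale g00D)
      show "fun_scale (scl s) a \<phi> x \<in> gm_m s" if "x \<in> gm_m s" for x
        unfolding fun_scale_def by (rule V.subspace_scale[OF gm(1) g00D(2)[OF p that]])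
      show "fun_scale (scl s) a \<phi> x \<in> gm_p s" if "x \<in> gm_p s" for x
        unfolding fun_scale_def by (rule V.subspace_scale[OF gm(2) g00D(3)[OF p that]])
    qed (use p g0c in \<open>auto simp: bsc subset_iff
          intro!: F.subspace_scale[OF g0'(1)] F.subspace_scale[OF g0'(2)] dest: g00D\<close>)
  qed
  have lie: "lie_bracket \<phi> \<psi> \<in> g00 s" if p: "\<phi> \<in> g00 s" "\<psi> \<in> g00 s" for \<phi> \<psi>
  proof (rule g00I)
    show "lie_bracket \<phi> \<psi> \<in> csp (scl s) (forms s)" using p by (intro csp_lie g00D)
    show "lie_bracket \<phi> \<psi> x \<in> gm_m s" if "x \<in> gm_m s" for x
      unfolding lie_bracket_def
      by (intro V.subspace_diff[OF gm(1)] g00D(2)[OF p(1)] g00D(2)[OF p(2)] that)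
    show "lie_bracket \<phi> \<psi> x \<in> gm_p s" if "x \<in> gm_p s" for x
      unfolding lie_bracket_def
      by (intro V.subspace_diff[OF gm(2)] g00D(3)[OF p(1)] g00D(3)[OF p(2)] that)
    show "lie_bracket (lie_bracket \<phi> \<psi>) \<xi> \<in> g0_m s" if "\<xi> \<in> g0_m s" for \<xi>
    proof -
      have c: "\<phi> \<in> csp (scl s) (forms s)" "\<psi> \<in> csp (scl s) (forms s)" "\<xi> \<in> csp (scl s) (forms s)"
        using p that g0c by (auto intro: g00D(1))
      show ?thesis
        unfolding jac[OF c]
        by (intro F.subspace_add[OF g0'(1)] F.subspace_scale[OF g0'(1)]
            g00D(4)[OF p(1)] g00D(4)[OF p(2)] that)
    qed
    show "lie_bracket (lie_bracket \<phi> \<psi>) \<xi> \<in> g0_p s" if "\<xi> \<in> g0_p s" for \<xi>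
    proof -
      have c: "\<phi> \<in> csp (scl s) (forms s)" "\<psi> \<in> csp (scl s) (forms s)" "\<xi> \<in> csp (scl s) (forms s)"
        using p that g0c by (auto intro: g00D(1))
      show ?thesis
        unfolding jac[OF c]
        by (intro F.subspace_add[OF g0'(2)] F.subspace_scale[OF g0'(2)]
            g00D(5)[OF p(1)] g00D(5)[OF p(2)] that)
    qed
  qed
  show ?thesis
    unfolding admissible_subalgebra_def using sub lie by (auto dest: g00D)
qed

definition regular_symbol :: "'v::ab_group_add cr_symbol \<Rightarrow> bool" where
  "regular_symbol s \<longleftrightarrow> (\<forall>\<phi>\<in>g0_m s. \<forall>\<psi>\<in>g0_p s. lie_bracket \<phi> \<psi> \<in> g00 s)"

definition nonregular_symbols :: "nat \<Rightarrow> nat \<Rightarrow> 'v::ab_group_add cr_symbol set" where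
  "nonregular_symbols n r = {s \<in> CR_symbols n r. \<not> regular_symbol s}"

definition mat_scale :: "complex \<Rightarrow> complex^'m^'m \<Rightarrow> complex^'m^'m" where
  "mat_scale c = map_matrix ((*) c)"

lemma vector_space_mat_scale: "vector_space mat_scale"
  by unfold_locales (auto simp: mat_scale_def vec_eq_iff algebra_simps)

definition hermitian :: "complex^'m^'m \<Rightarrow> bool" where
  "hermitian H \<longleftrightarrow> transpose H = map_matrix cnj H"

(* The parameter space of r-tuples, with r = CARD('r), for a fixed matrix H of the
   reduced Levi form. *)
definition symbol_params :: "complex^'m^'m \<Rightarrow> (complex^'m^'m^'r) set" where
  "symbol_params H = {C. inj (($) C) \<and> \<not> module.dependent mat_scale (range (($) C)) \<and>
     (\<forall>i. transpose (C $ i ** matrix_inv H) = C $ i ** matrix_inv H)}"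

(* The Hermitian form ell(x,y) = (i/2) [x, conj y] has matrix H = (ell(e_i,e_j)), and the
   matrix A of an element of g_{0,2} has as its j-th column the coordinates of the image of
   conj e_j. With these conventions membership in csp means that A H^{-1} is
   symmetric. The choice of omega among the real forms accounts for ell being defined up to
   real scale. By conjugation, g_{0,-2} is then represented by the conjugate matrices. *)
definition represented_by ::
  "'v::ab_group_add cr_symbol \<Rightarrow> complex^'m^'m \<Rightarrow> complex^'m^'m^'r \<Rightarrow> bool" where
  "represented_by s H C \<longleftrightarrow> (\<exists>e \<omega>. \<omega> \<in> real_forms s \<and>
     inj e \<and> \<not> module.dependent (scl s) (range e) \<and> module.span (scl s) (range e) = gm_p s \<and>
     (\<forall>i j. H $ i $ j = \<i> / 2 * \<omega> (e i) (invol s (e j))) \<and>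
     {A. \<exists>\<phi>\<in>g0_p s. \<forall>j. \<phi> (invol s (e j)) = (\<Sum>i\<in>UNIV. scl s (A $ i $ j) (e i))}
       = module.span mat_scale (range (($) C)))"

(* Real polynomials on complex^'m^'m^'r are polynomials in the real and imaginary parts
   of the matrix entries. *)
definition real_algebraic_subset :: "'a::real_normed_vector set \<Rightarrow> 'a set \<Rightarrow> bool" where
  "real_algebraic_subset P A \<longleftrightarrow>
     (\<exists>F. (\<forall>p\<in>F. real_polynomial_function p) \<and> A = {x \<in> P. \<forall>p\<in>F. p x = 0})"

(* The index types encode the ranks: CARD('m) = n - r and CARD('r) = r. Each invertible
   Hermitian H is treated, hence each signature with every choice of H. *)
definition generic_symbols ::
  "'m::finite itself \<Rightarrow> 'r::finite itself \<Rightarrow> 'v::ab_group_add cr_symbol set \<Rightarrow> bool" where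
  "generic_symbols _ _ S \<longleftrightarrow>
     (\<forall>H :: complex^'m^'m. hermitian H \<and> invertible H \<longrightarrow>
       (\<exists>A :: (complex^'m^'m^'r) set.
          real_algebraic_subset (symbol_params H) A \<and> A \<noteq> symbol_params H \<and>
          (\<forall>C \<in> symbol_params H - A.
             \<forall>s \<in> CR_symbols (CARD('m) + CARD('r)) CARD('r).
               represented_by s H C \<longrightarrow> s \<in> S)))"

end

theory Submission
  imports Defs
begin

text \<open>
  In a basis, \<open>\<gg>\<^sub>0\<^sub>,\<^sub>2\<close> is the span \<open>W\<close> of the matrices \<open>C\<^sub>i\<close> and \<open>\<gg>\<^sub>0\<^sub>,\<^sub>-\<^sub>2\<close> is the span of their
  conjugates. If the symbol is regular, then for \<open>\<phi> \<in> \<gg>\<^sub>0\<^sub>,\<^sub>2\<close> with conjugate \<open>\<psi>\<close> the double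
  bracket \<open>[[\<psi>, \<phi>], \<phi>] = -2 \<phi>\<psi>\<phi>\<close> lies in \<open>\<gg>\<^sub>0\<^sub>,\<^sub>2\<close> again, so \<open>W\<close> is closed under the cube
  \<open>A \<mapsto> A (cnj A) A\<close> (lemma \<open>regular_symbol_cubic_in_span\<close>). Genericity of nonregularity therefore
  needs two things.

  First, some tuple must violate this closure condition, whatever the signature of \<open>H\<close>. For vectors
  \<open>x\<close>, \<open>y\<close> that are orthogonal for the Hermitian form \<open>h\<close> of \<open>H\<close>, the matrix
  \<open>A = (x x\<^sup>T + y y\<^sup>T) H\<close> has the cube \<open>(\<bar>h(x,x)\<bar>\<^sup>2 x x\<^sup>T + \<bar>h(y,y)\<bar>\<^sup>2 y y\<^sup>T) H\<close>, which is not a multiple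
  of \<open>A\<close> as soon as \<open>\<bar>h(x,x)\<bar> \<noteq> \<bar>h(y,y)\<bar>\<close> (lemma \<open>ex_cubic_not_multiple\<close>). Because \<open>r\<close> is smaller
  than the dimension \<open>m(m+1)/2\<close> of the space of all matrices \<open>S H\<close> with \<open>S\<close> symmetric, \<open>A\<close> can be
  completed to a tuple of \<open>r\<close> independent elements of this space whose span misses the cube of \<open>A\<close>
  (lemma \<open>ex_params_cubic_outside_span\<close>).

  Second, the condition that the cube of \<open>C\<^sub>i\<close> lies in \<open>W\<close> must be contained in the zero set of a real
  polynomial that does not vanish at this tuple. A linear map \<open>\<Phi>\<close> sending the tuple and the cube to
  the standard basis of an \<open>(r+1)\<close>-dimensional space turns \<open>(C\<^sub>1, ..., C\<^sub>r)\<close> and the cube of \<open>C\<^sub>i\<close> into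
  the rows of a square matrix. The real part of its determinant is a polynomial in the real and
  imaginary parts of the entries. It is \<open>1\<close> at the chosen tuple and \<open>0\<close> wherever the cube is a linear
  combination of the \<open>C\<^sub>j\<close>.
\<close>

interpretation mat: vector_space "mat_scale :: complex \<Rightarrow> complex^'m^'m \<Rightarrow> complex^'m^'m"
  by (rule vector_space_mat_scale)

definition cubic :: "complex^'m^'m \<Rightarrow> complex^'m^'m" where
  "cubic A = A ** map_matrix cnj A ** A"

section \<open>Regularity as a closure condition on matrices\<close>

text \<open>
  The element \<open>\<phi>\<close> of \<open>\<gg>\<^sub>0\<^sub>,\<^sub>2\<close> with matrix \<open>A\<close> has the conjugate \<open>\<psi>\<close> with matrix \<open>cnj A\<close>. On
  \<open>\<gg>\<^sub>-\<^sub>1\<^sub>,\<^sub>-\<^sub>1\<close> both \<open>\<psi>\<close> and \<open>\<phi>\<phi>\<close> vanish, so only the two equal terms \<open>-\<phi>\<psi>\<phi>\<close> of \<open>[[\<psi>, \<phi>], \<phi>]\<close> survive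
  there.
\<close>

lemma regular_symbol_cubic_in_span:
  fixes C :: "complex^'m^'m^'r" and A :: "complex^'m^'m"
  assumes s: "s \<in> CR_symbols n r" and rep: "represented_by s H C" and reg: "regular_symbol s"
    and A: "A \<in> mat.span (range (($) C))"
  shows "cubic A \<in> mat.span (range (($) C))"
proof -
  obtain e where span: "module.span (scl s) (range e) = gm_p s"
    and repr: "{A. \<exists>\<phi>\<in>g0_p s. \<forall>j. \<phi> (invol s (e j)) = (\<Sum>i\<in>UNIV. scl s (A $ i $ j) (e i))}
       = mat.span (range (($) C))"
    using rep unfolding represented_by_def by blast
  note D = s[unfolded CR_symbols_def mem_Collect_eq]
  have vs: "vector_space (scl s)" and inv: "antilinear_involution (scl s) (invol s)"
    and g0c: "g0_m s \<subseteq> csp (scl s) (forms s)" "g0_p s \<subseteq> csp (scl s) (forms s)"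
    and pz': "\<forall>\<phi>\<in>g0_p s. \<phi> ` gm_m s \<subseteq> gm_p s \<and> (\<forall>x\<in>gm_p s. \<phi> x = 0)"
    and mz': "\<forall>\<phi>\<in>g0_m s. \<phi> ` gm_p s \<subseteq> gm_m s \<and> (\<forall>x\<in>gm_m s. \<phi> x = 0)"
    and conj: "(\<lambda>\<phi>. invol s \<circ> \<phi> \<circ> invol s) ` g0_p s = g0_m s"
    and swap: "invol s ` gm_p s = gm_m s"
    using D by - (elim conjE, assumption)+
  have pz: "\<phi> x = 0" if "\<phi> \<in> g0_p s" "x \<in> gm_p s" for \<phi> x using pz' that by blast
  have mz: "\<psi> x = 0" if "\<psi> \<in> g0_m s" "x \<in> gm_m s" for \<psi> x using mz' that by blast
  interpret V: vector_space "scl s" by (rule vs)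
  interpret VV: vector_space_pair "scl s" "scl s" ..
  have e: "e j \<in> gm_p s" for j unfolding span[symmetric] by (rule V.span_base) simp
  obtain \<phi> where \<phi>: "\<phi> \<in> g0_p s"
    and \<phi>e: "\<And>j. \<phi> (invol s (e j)) = (\<Sum>i\<in>UNIV. scl s (A $ i $ j) (e i))"
    using A repr by blast
  define \<psi> where "\<psi> = invol s \<circ> \<phi> \<circ> invol s"
  define \<tau> where "\<tau> = lie_bracket \<psi> \<phi>"
  have \<psi>: "\<psi> \<in> g0_m s" using conj \<phi> unfolding \<psi>_def by blast
  have "\<tau> \<in> g00 s" using reg \<phi> \<psi> unfolding regular_symbol_def \<tau>_def by blast
  then have brk: "lie_bracket \<tau> \<phi> \<in> g0_p s" using \<phi> unfolding g00_def by blast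
  have lin: "Vector_Spaces.linear (scl s) (scl s) \<phi>" "Vector_Spaces.linear (scl s) (scl s) \<psi>"
    using g0c \<phi> \<psi> by (auto simp: csp_def)
  note ls = VV.linear_sum[OF lin(1)] VV.linear_scale[OF lin(1)] VV.linear_0[OF lin(1)]
    VV.linear_diff[OF lin(1)] VV.linear_0[OF lin(2)]
  have sadd: "invol s (x + y) = invol s x + invol s y" for x y
    using inv by (simp add: antilinear_involution_def)
  have ssc: "invol s (scl s c x) = scl s (cnj c) (invol s x)" for x c
    using inv by (simp add: antilinear_involution_def)
  have s0: "invol s 0 = 0" using sadd[of 0 0] by simp
  have ssum: "invol s (sum f I) = (\<Sum>i\<in>I. invol s (f i))" for f :: "'m \<Rightarrow> 'a" and I
    by (induction I rule: infinite_finite_induct) (auto simp: s0 sadd)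
  have comb: "(\<Sum>i\<in>UNIV. scl s (c i) (e i)) \<in> gm_p s" for c
    unfolding span[symmetric] by (intro V.span_sum V.span_scale V.span_base) auto
  have \<psi>e: "\<psi> (e i) = (\<Sum>k\<in>UNIV. scl s (cnj (A $ k $ i)) (invol s (e k)))" for i
    by (simp add: \<psi>_def \<phi>e ssum ssc)
  have \<phi>\<psi>e: "\<phi> (\<psi> (e i)) = (\<Sum>l\<in>UNIV. scl s ((A ** map_matrix cnj A) $ l $ i) (e l))" for i
    unfolding \<psi>e ls \<phi>e V.scale_sum_right
    by (subst sum.swap) (simp add: matrix_matrix_mult_def V.scale_sum_left mult.commute)
  have lpsi: "\<psi> (\<Sum>i\<in>UNIV. scl s (c i) (e i)) = (\<Sum>i\<in>UNIV. scl s (c i) (\<psi> (e i)))" for c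
    by (simp add: VV.linear_sum[OF lin(2)] VV.linear_scale[OF lin(2)])
  have triple: "\<phi> (\<psi> (\<phi> (invol s (e j)))) =
      (\<Sum>l\<in>UNIV. scl s ((A ** map_matrix cnj A ** A) $ l $ j) (e l))" for j
    unfolding \<phi>e lpsi ls \<phi>\<psi>e V.scale_sum_right
    by (subst sum.swap) (simp add: matrix_matrix_mult_def[of "A ** map_matrix cnj A"]
        V.scale_sum_left mult.commute)
  have "lie_bracket \<tau> \<phi> (invol s (e j)) =
      (\<Sum>l\<in>UNIV. scl s (mat_scale (-2) (A ** map_matrix cnj A ** A) $ l $ j) (e l))" for j
  proof -
    have "\<psi> (invol s (e j)) = 0" using mz[OF \<psi>] swap e by blast
    moreover have "\<phi> (\<phi> (invol s (e j))) = 0" unfolding \<phi>e by (rule pz[OF \<phi> comb])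
    ultimately have "lie_bracket \<tau> \<phi> (invol s (e j)) =
        scl s (-2) (\<phi> (\<psi> (\<phi> (invol s (e j)))))"
      unfolding lie_bracket_def \<tau>_def ls
      using V.scale_left_distrib[of 1 1] by (simp add: ls)
    then show ?thesis by (simp add: triple V.scale_sum_right mat_scale_def)
  qed
  then have "mat_scale (-2) (A ** map_matrix cnj A ** A) \<in> mat.span (range (($) C))"
    using brk unfolding repr[symmetric] by blast
  from mat.span_scale[OF this, of "-1/2"] show ?thesis
    by (simp add: cubic_def)
qed

section \<open>A symmetric matrix with noncollinear cubic\<close>

lemma matrix_inv_right:
  assumes "invertible H"
  shows "H ** matrix_inv H = mat 1"
  using someI_ex[OF assms[unfolded invertible_def]] by (simp add: matrix_inv_def)

definition cnj_vec :: "complex^'m \<Rightarrow> complex^'m" where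
  "cnj_vec x = (\<chi> i. cnj (x $ i))"

text \<open>Bilinear, not sesquilinear: \<open>bil x y\<close> is \<open>x\<^sup>T y\<close>.\<close>

definition bil :: "complex^'m \<Rightarrow> complex^'m \<Rightarrow> complex" where
  "bil x y = (\<Sum>i\<in>UNIV. x $ i * y $ i)"

lemma bil_linear:
  "bil (x + y) z = bil x z + bil y z" "bil z (x + y) = bil z x + bil z y"
  "bil z (x - y) = bil z x - bil z y"
  "bil (c *s x) z = c * bil x z" "bil z (c *s x) = c * bil z x"
  by (simp_all add: bil_def algebra_simps sum.distrib sum_subtractf sum_distrib_left)

lemma cnj_vec_simps:
  "cnj_vec (x + y) = cnj_vec x + cnj_vec y" "cnj_vec (c *s x) = cnj c *s cnj_vec x"
  "cnj_vec (cnj_vec x) = x"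
  by (simp_all add: cnj_vec_def vec_eq_iff)

lemma map_matrix_cnj_mult_vec: "map_matrix cnj A *v cnj_vec x = cnj_vec (A *v x)"
  by (simp add: cnj_vec_def matrix_vector_mult_def vec_eq_iff)

lemma bil_cnj_vec_eq_0_iff: "bil x (cnj_vec x) = 0 \<longleftrightarrow> x = 0"
proof -
  have "bil x (cnj_vec x) = of_real (\<Sum>i\<in>UNIV. (cmod (x $ i))\<^sup>2)"
    by (simp add: bil_def cnj_vec_def complex_norm_square[symmetric] del: of_real_power)
  then show ?thesis
    by (simp add: sum_nonneg_eq_0_iff vec_eq_iff del: of_real_sum)
qed

text \<open>
  With the conjugation on the second argument, this is the reduced Levi form whose matrix is \<open>H\<close>
  (see \<open>herm_form_axis\<close>).
\<close>

definition herm_form :: "complex^'m^'m \<Rightarrow> complex^'m \<Rightarrow> complex^'m \<Rightarrow> complex" where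
  "herm_form H x y = bil x (H *v cnj_vec y)"

lemma herm_form_sesquilinear:
  "herm_form H (x + y) z = herm_form H x z + herm_form H y z"
  "herm_form H z (x + y) = herm_form H z x + herm_form H z y"
  "herm_form H (c *s x) z = c * herm_form H x z"
  "herm_form H z (c *s x) = cnj c * herm_form H z x"
  by (simp_all add: herm_form_def cnj_vec_simps bil_linear matrix_vector_right_distrib
      vector_scalar_commute)

lemma herm_form_commute:
  assumes "hermitian H"
  shows "herm_form H y x = cnj (herm_form H x y)"
proof -
  have H: "H $ i $ j = cnj (H $ j $ i)" for i j
    using arg_cong[where f="\<lambda>M. M $ j $ i", OF assms[unfolded hermitian_def]]
    by (simp add: transpose_def)
  have "herm_form H y x = (\<Sum>i\<in>UNIV. \<Sum>j\<in>UNIV. y $ i * (cnj (H $ j $ i) * cnj (x $ j)))"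
    by (simp add: herm_form_def bil_def cnj_vec_def matrix_vector_mult_def sum_distrib_left
        flip: H)
  also have "\<dots> = cnj (herm_form H x y)"
    by (subst sum.swap)
      (simp add: herm_form_def bil_def cnj_vec_def matrix_vector_mult_def sum_distrib_left
        mult_ac)
  finally show ?thesis .
qed

lemma herm_form_axis: "herm_form H (axis i 1) (axis j 1) = H $ i $ j"
proof -
  have "cnj_vec (axis j 1) = axis j 1" by (auto simp: cnj_vec_def axis_def vec_eq_iff)
  moreover have "bil (axis i 1) v = v $ i" for v :: "complex^'a"
    by (simp add: bil_def axis_def if_distrib[of "\<lambda>a. a * _"] cong: if_cong)
  ultimately show ?thesis
    by (simp add: herm_form_def matrix_vector_mult_def axis_def if_distrib[of "\<lambda>a. _ * a"]
        cong: if_cong)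
qed

text \<open>
  Polarization: if all vectors are isotropic, then \<open>x + y\<close> and \<open>x + \<i> y\<close> show that both the
  symmetric and the antisymmetric part of \<open>h(x,y)\<close> vanish, and then so does every entry of \<open>H\<close>.
\<close>

lemma ex_nonisotropic:
  fixes H :: "complex^'m^'m"
  assumes "H \<noteq> 0"
  shows "\<exists>x. herm_form H x x \<noteq> 0"
proof (rule ccontr)
  assume "\<not> ?thesis"
  then have iso: "herm_form H x x = 0" for x by blast
  have "herm_form H x y = 0" for x y
  proof -
    have "herm_form H x y + herm_form H y x = 0"
      using iso[of "x + y"] by (simp add: herm_form_sesquilinear iso add.commute)
    moreover have "\<i> * herm_form H y x - \<i> * herm_form H x y = 0"
      using iso[of "x + \<i> *s y"] by (simp add: herm_form_sesquilinear iso)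
    ultimately show ?thesis by (simp add: complex_eq_iff)
  qed
  then have "H = 0" by (simp add: vec_eq_iff flip: herm_form_axis)
  with assms show False ..
qed

text \<open>
  Dimension two leaves room for a nonzero \<open>y\<close> orthogonal to a nonisotropic \<open>x\<close>. Rescaling \<open>y\<close> by 2
  multiplies \<open>h(y,y)\<close> by 4, which separates the two absolute values if they happen to coincide. The
  vector \<open>y\<close> may be isotropic, so indefinite forms need no separate treatment.
\<close>

lemma ex_orthogonal_nonisotropic_norms_differ:
  fixes H :: "complex^'m^'m"
  assumes H: "hermitian H" "H \<noteq> 0" and two: "2 \<le> CARD('m)"
  obtains x y where "x \<noteq> 0" "y \<noteq> 0" "herm_form H x y = 0" "herm_form H y x = 0"
    "herm_form H x x \<noteq> 0" "cmod (herm_form H x x) \<noteq> cmod (herm_form H y y)"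
proof -
  obtain x where x: "herm_form H x x \<noteq> 0" using ex_nonisotropic[OF H(2)] by blast
  then have x0: "x \<noteq> 0" by (auto simp: herm_form_def bil_def)
  define u where "u = H *v cnj_vec x"
  have "u \<noteq> 0" using x by (auto simp: herm_form_def u_def bil_def)
  then obtain i where i: "u $ i \<noteq> 0" by (auto simp: vec_eq_iff)
  obtain j where j: "j \<noteq> i"
  proof -
    have "\<not> (UNIV :: 'm set) \<subseteq> {i}"
      using two card_mono[of "{i}" "UNIV :: 'm set"] by auto
    then show ?thesis using that by blast
  qed
  \<comment> \<open>the vector with entries \<open>-u\<^sub>j\<close>, \<open>u\<^sub>i\<close> in the positions \<open>i\<close>, \<open>j\<close> is annihilated by \<open>u\<close>\<close>
  define y where "y = (\<chi> k. if k = j then u $ i else if k = i then - u $ j else 0)"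
  have "bil y u = (\<Sum>k\<in>{i, j}. y $ k * u $ k)"
    unfolding bil_def by (rule sum.mono_neutral_right) (auto simp: y_def)
  then have yx: "herm_form H y x = 0" using j by (simp add: herm_form_def u_def[symmetric]) (simp add: y_def)
  then have xy: "herm_form H x y = 0" using herm_form_commute[OF H(1), of x y] by simp
  have y: "y \<noteq> 0" using i by (auto simp: vec_eq_iff y_def)
  show ?thesis
  proof (cases "cmod (herm_form H x x) = cmod (herm_form H y y)")
    case False
    then show ?thesis using that[of x y] x x0 y xy yx by blast
  next
    case True
    then have "cmod (herm_form H (2 *s y) (2 *s y)) \<noteq> cmod (herm_form H x x)"
      using x by (auto simp: herm_form_sesquilinear norm_mult)
    then show ?thesis using that[of x "2 *s y"] x x0 y xy yx
      by (auto simp: herm_form_sesquilinear)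
  qed
qed

text \<open>
  For \<open>S = x x\<^sup>T + y y\<^sup>T\<close> with \<open>x\<close>, \<open>y\<close> orthogonal as above, \<open>C = S H\<close> maps the conjugate of \<open>x\<close> to
  \<open>h(x,x) x\<close>, and likewise for \<open>y\<close>. Hence \<open>C (cnj C)\<close> acts on \<open>x\<close> and \<open>y\<close> by the different factors
  \<open>\<bar>h(x,x)\<bar>\<^sup>2\<close> and \<open>\<bar>h(y,y)\<bar>\<^sup>2\<close>, whereas both would equal \<open>c\<close> if the cube of \<open>C\<close> were \<open>c C\<close>, because
  \<open>x\<close> and \<open>y\<close> lie in the range of \<open>C\<close>.
\<close>

lemma ex_cubic_not_multiple:
  fixes H :: "complex^'m^'m"
  assumes H: "hermitian H" "invertible H" and two: "2 \<le> CARD('m)"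
  obtains S where "transpose S = S" "S ** H \<noteq> 0"
    "\<And>c. cubic (S ** H) \<noteq> mat_scale c (S ** H)"
proof -
  have "H \<noteq> 0"
  proof
    assume "H = 0"
    then have "mat 1 = (0 :: complex^'m^'m)"
      using matrix_inv_right[OF H(2)] by (simp add: matrix_matrix_mult_def vec_eq_iff)
    then have "(mat 1 :: complex^'m^'m) $ i $ i = 0" for i by simp
    then show False by (simp add: mat_def)
  qed
  from ex_orthogonal_nonisotropic_norms_differ[OF H(1) this two]
  obtain x y where x0: "x \<noteq> 0" and y0: "y \<noteq> 0"
    and xy: "herm_form H x y = 0" and yx: "herm_form H y x = 0"
    and xx: "herm_form H x x \<noteq> 0" and ne: "cmod (herm_form H x x) \<noteq> cmod (herm_form H y y)"
    by blast
  define S where "S = (\<chi> k l. x $ k * x $ l + y $ k * y $ l)"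
  define C where "C = S ** H"
  have Cw: "C *v w = bil x (H *v w) *s x + bil y (H *v w) *s y" for w
  proof -
    have "S *v v = bil x v *s x + bil y v *s y" for v
      by (simp add: S_def bil_def matrix_vector_mult_def vec_eq_iff algebra_simps sum.distrib
          sum_distrib_left)
    then show ?thesis by (simp add: C_def flip: matrix_vector_mul_assoc)
  qed
  have Cx: "C *v cnj_vec x = herm_form H x x *s x" and Cy: "C *v cnj_vec y = herm_form H y y *s y"
    using xy yx by (simp_all add: Cw flip: herm_form_def)
  have cub: "C *v (map_matrix cnj C *v (c *s z)) = (c * (a * cnj a)) *s z"
    if "C *v cnj_vec z = a *s z" for a c z
    using map_matrix_cnj_mult_vec[of C "cnj_vec z"] that
    by (simp add: cnj_vec_simps vector_scalar_commute vector_smult_assoc mult_ac)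
  have "C *v cnj_vec x \<noteq> 0" unfolding Cx using x0 xx by simp
  then have C0: "C \<noteq> 0" by auto
  have "cubic C \<noteq> mat_scale c C" for c
  proof
    assume eq: "cubic C = mat_scale c C"
    have sc: "mat_scale c C *v w = c *s (C *v w)" for w
      by (simp add: mat_scale_def matrix_vector_mult_def vec_eq_iff sum_distrib_left mult_ac)
    have eqv: "C *v (map_matrix cnj C *v (C *v w)) = c *s (C *v w)" for w
      using arg_cong[where f="\<lambda>M. M *v w", OF eq] by (simp add: sc cubic_def matrix_vector_mul_assoc matrix_mul_assoc)
    have 1: "herm_form H x x * cnj (herm_form H x x) = c"
      using eqv[of "cnj_vec x"] xx x0 by (simp add: Cx cub[OF Cx] vector_smult_assoc)
    \<comment> \<open>Since \<open>h(y,y)\<close> may be \<open>0\<close>, the conjugate of \<open>y\<close> need not be mapped to a nonzero multiple of \<open>y\<close>.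
      The vector \<open>w\<close> is: \<open>H w\<close> is the conjugate of \<open>y\<close>, corrected so that \<open>x\<^sup>T H w = 0\<close>.\<close>
    define w where "w = matrix_inv H *v cnj_vec y - (bil x (cnj_vec y) / herm_form H x x) *s cnj_vec x"
    have "H *v (matrix_inv H *v cnj_vec y) = cnj_vec y"
      using matrix_inv_right[OF H(2)] by (simp add: matrix_vector_mul_assoc)
    then have Hw: "H *v w = cnj_vec y - (bil x (cnj_vec y) / herm_form H x x) *s (H *v cnj_vec x)"
      by (simp add: w_def matrix_vector_mult_diff_distrib vector_scalar_commute)
    have "C *v w = bil y (cnj_vec y) *s y"
      using xx yx by (simp add: Cw Hw bil_linear flip: herm_form_def)
    then have 2: "herm_form H y y * cnj (herm_form H y y) = c"
      using eqv[of w] y0 by (simp add: cub[OF Cy] vector_smult_assoc bil_cnj_vec_eq_0_iff)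
    from 1 2 have "cmod (herm_form H x x) ^ 2 = cmod (herm_form H y y) ^ 2"
      by (metis complex_norm_square of_real_eq_iff)
    with ne show False by simp
  qed
  with C0 show ?thesis
    by (intro that[of S]) (simp_all add: C_def, simp add: S_def transpose_def vec_eq_iff mult.commute)
qed

section \<open>Parameter tuples whose span is not closed under cubes\<close>

text \<open>
  A basis of \<open>U\<close> containing \<open>a\<close> and \<open>b\<close> has more elements than \<open>'r\<close>, so it contains a family indexed
  by \<open>'r\<close> that includes \<open>a\<close> and omits \<open>b\<close>. By independence of the basis, \<open>b\<close> is not in the span of
  that family.
\<close>

lemma (in vector_space) independent_family_containing:
  assumes ab: "independent {a, b}" "a \<noteq> b" "{a, b} \<subseteq> U"
    and I: "independent I" "I \<subseteq> U" "CARD('r::finite) < card I"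
  obtains f :: "'r::finite \<Rightarrow> 'b" and i where "f i = a" "inj f" "range f \<subseteq> U"
    "independent (range f)" "b \<notin> span (range f)"
proof -
  obtain B where B: "{a, b} \<subseteq> B" "B \<subseteq> U" "independent B" "U \<subseteq> span B"
    by (rule maximal_independent_subset_extend[OF ab(3,1)])
  have "\<exists>D. finite D \<and> card D = CARD('r) - 1 \<and> D \<subseteq> B - {a, b}"
  proof (cases "finite B")
    case True
    have "card I \<le> card B" using independent_span_bound[OF True I(1) subset_trans[OF I(2) B(4)]] ..
    moreover have "card (B - {a, b}) = card B - 2"
      using ab(2) by (subst card_Diff_subset[OF _ B(1)]) simp_all
    ultimately have "CARD('r) - 1 \<le> card (B - {a, b})" using I(3) by linarith
    then obtain D where "D \<subseteq> B - {a, b}" "card D = CARD('r) - 1" "finite D"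
      by (rule obtain_subset_with_card_n)
    then show ?thesis by blast
  next
    case False
    then have "infinite (B - {a, b})" by simp
    from infinite_arbitrarily_large[OF this] show ?thesis .
  qed
  then obtain D where D: "finite D" "card D = CARD('r) - 1" "D \<subseteq> B - {a, b}" by blast
  have "a \<notin> D" using D(3) by blast
  then have "card (insert a D) = CARD('r)" using D(1,2) by (simp add: Suc_leI)
  then have "\<exists>f :: 'r \<Rightarrow> 'b. bij_betw f UNIV (insert a D)"
    using D(1) by (intro finite_same_card_bij) simp_all
  then obtain f :: "'r \<Rightarrow> 'b" where "bij_betw f UNIV (insert a D)" ..
  then have f: "inj f" "range f = insert a D" by (auto simp: bij_betw_def)
  have "a \<in> range f" unfolding f(2) by simp
  then obtain i where fi: "f i = a" by blast
  have sub: "range f \<subseteq> B - {b}" using D(3) B(1) ab(2) unfolding f(2) by blast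
  have "b \<notin> span (B - {b})" using B(1,3) unfolding dependent_def by blast
  then have out: "b \<notin> span (range f)" using span_mono[OF sub] by blast
  have ind: "independent (range f)" by (rule independent_mono[OF B(3)]) (use sub in blast)
  have "range f \<subseteq> U" using sub B(2) by blast
  from that[OF fi f(1) this ind out] show ?thesis .
qed

text \<open>
  The standard basis of the symmetric matrices, indexed by the nonempty sets of at most two indices:
  a singleton gives a diagonal unit, a pair the sum of two off-diagonal ones. Sets rather than ordered
  pairs \<open>i \<le> j\<close> make an order on the index type unnecessary.
\<close>

definition sym_unit :: "'m set \<Rightarrow> complex^'m^'m" where
  "sym_unit X = (\<chi> i j. of_bool ({i, j} = X))"

lemma card_unordered_pairs:
  "card {X :: 'm::finite set. card X = 1 \<or> card X = 2} = (CARD('m) + 1) choose 2"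
proof -
  have "{X :: 'm set. card X = 1 \<or> card X = 2} = {X. X \<subseteq> UNIV \<and> card X = 1} \<union> {X. X \<subseteq> UNIV \<and> card X = 2}"
    by auto
  also have "card \<dots> = (CARD('m) choose 1) + (CARD('m) choose 2)"
    by (subst card_Un_disjoint) (auto simp: n_subsets[of "UNIV :: 'm set", simplified])
  finally show ?thesis by (simp add: numeral_2_eq_2)
qed

text \<open>
  The space of symmetric matrices times \<open>H\<close> has dimension at least \<open>m(m+1)/2\<close>: different
  \<open>sym_unit X\<close> have disjoint supports, so an entry indexed by the elements of \<open>X\<close> vanishes on the
  span of all others.
\<close>

lemma independent_sym_units:
  fixes H :: "complex^'m^'m"
  assumes H: "invertible H"
  obtains I where "\<not> mat.dependent I" "card I = (CARD('m) + 1) choose 2"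
    "I \<subseteq> {A. transpose (A ** matrix_inv H) = A ** matrix_inv H}"
proof -
  let ?P = "{X :: 'm set. card X = 1 \<or> card X = 2}"
  define f where "f X = sym_unit X ** H" for X
  have HH: "H ** matrix_inv H = mat 1" using matrix_inv_right[OF H] .
  have f_inv: "f X ** matrix_inv H = sym_unit X" for X
    by (simp add: f_def HH flip: matrix_mul_assoc)
  have pair: "\<exists>i j. X = {i, j}" if "X \<in> ?P" for X :: "'m set"
    using that by (auto simp: card_1_singleton_iff card_2_iff)
  have off: "A \<in> mat.span (f ` (?P - {{i, j}})) \<Longrightarrow> (A ** matrix_inv H) $ i $ j = 0" for A i j
  proof (induction rule: mat.span_induct_alt)
    case (step c A B)
    then have "(mat_scale c A ** matrix_inv H) $ i $ j = 0"
    proof -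
      from step(1) obtain X where X: "X \<noteq> {i, j}" "A = f X" by blast
      have "(mat_scale c A ** matrix_inv H) $ i $ j = c * (A ** matrix_inv H) $ i $ j"
        by (simp add: mat_scale_def matrix_matrix_mult_def sum_distrib_left mult_ac)
      then show ?thesis using X by (auto simp: f_inv sym_unit_def)
    qed
    with step(2) show ?case by (simp add: matrix_matrix_mult_def distrib_right sum.distrib)
  qed simp
  have notin: "f X \<notin> mat.span (f ` (?P - {X}))" if X: "X \<in> ?P" for X
  proof -
    obtain i j where ij: "X = {i, j}" using pair[OF X] by blast
    have "(f X ** matrix_inv H) $ i $ j = 1" by (simp add: f_inv sym_unit_def ij)
    then show ?thesis using off[of "f X" i j] ij by auto
  qed
  have inj: "inj_on f ?P"
  proof (rule inj_onI, rule ccontr)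
    fix X Y assume XY: "X \<in> ?P" "Y \<in> ?P" "f X = f Y" "X \<noteq> Y"
    then have "f Y \<in> mat.span (f ` (?P - {X}))" by (intro mat.span_base) blast
    with notin[OF XY(1)] XY(3) show False by simp
  qed
  have "\<not> mat.dependent (f ` ?P)"
  proof
    assume "mat.dependent (f ` ?P)"
    then obtain X where "X \<in> ?P" "f X \<in> mat.span (f ` ?P - {f X})"
      unfolding mat.dependent_def by blast
    moreover have "f ` ?P - {f X} \<subseteq> f ` (?P - {X})" by blast
    ultimately show False using notin mat.span_mono by blast
  qed
  moreover have "card (f ` ?P) = (CARD('m) + 1) choose 2"
    unfolding card_image[OF inj] by (rule card_unordered_pairs)
  moreover have "transpose (sym_unit X) = sym_unit X" for X :: "'m set"
    by (simp add: transpose_def sym_unit_def vec_eq_iff insert_commute)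
  then have "f ` ?P \<subseteq> {A. transpose (A ** matrix_inv H) = A ** matrix_inv H}"
    by (auto simp: f_inv)
  ultimately show ?thesis by (rule that)
qed

text \<open>
  For \<open>A = S H\<close> the cube is \<open>S H (cnj S) (cnj H) S H\<close>. Since \<open>H\<close> is Hermitian, transposition
  exchanges \<open>H\<close> and \<open>cnj H\<close>, so the factor in front of the last \<open>H\<close> is a symmetric product.
\<close>

lemma cubic_symmetric:
  fixes H S :: "complex^'m^'m"
  assumes H: "hermitian H" "invertible H" and S: "transpose S = S"
  shows "transpose (cubic (S ** H) ** matrix_inv H) = cubic (S ** H) ** matrix_inv H"
proof -
  have cnj_mult: "map_matrix cnj (A ** B) = map_matrix cnj A ** map_matrix cnj B" for A B :: "complex^'m^'m"
    by (simp add: matrix_matrix_mult_def vec_eq_iff)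
  have cnj_transpose: "transpose (map_matrix cnj A) = map_matrix cnj (transpose A)" for A :: "complex^'m^'m"
    by (simp add: transpose_def vec_eq_iff)
  have HT: "transpose H = map_matrix cnj H" using H(1) by (simp add: hermitian_def)
  have HH: "map_matrix cnj (map_matrix cnj H) = H" by (simp add: vec_eq_iff)
  have "cubic (S ** H) ** matrix_inv H = S ** H ** (map_matrix cnj S ** (map_matrix cnj H ** S))"
    by (simp add: cubic_def cnj_mult matrix_inv_right[OF H(2)] flip: matrix_mul_assoc)
  then show ?thesis
    by (simp add: matrix_transpose_mul cnj_transpose S HT HH matrix_mul_assoc)
qed

text \<open>
  The strict inequality on \<open>r\<close> enters twice: it leaves room for the cube outside the span, and, as
  \<open>r\<close> is positive, it forces matrices of size at least two, without which every cube is a multiple.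
\<close>

lemma ex_params_cubic_outside_span:
  fixes H :: "complex^'m^'m"
  assumes H: "hermitian H" "invertible H" and r: "CARD('r::finite) < (CARD('m) + 1) choose 2"
  obtains C :: "complex^'m^'m^'r" and i
  where "C \<in> symbol_params H" "cubic (C $ i) \<notin> mat.span (range (($) C))"
proof -
  let ?U = "{A. transpose (A ** matrix_inv H) = A ** matrix_inv H}"
  have "2 \<le> CARD('m)"
  proof (rule ccontr)
    assume "\<not> ?thesis"
    moreover have "0 < CARD('m)" "0 < CARD('r)" by simp_all
    ultimately have "CARD('m) = 1" by linarith
    with r \<open>0 < CARD('r)\<close> show False by (simp add: numeral_2_eq_2)
  qed
  from ex_cubic_not_multiple[OF H this] obtain S where S: "transpose S = S" "S ** H \<noteq> 0"
    and ne: "\<And>c. cubic (S ** H) \<noteq> mat_scale c (S ** H)"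
    by blast
  have out: "cubic (S ** H) \<notin> mat.span {S ** H}"
    using ne by (auto simp: mat.span_singleton)
  have ind: "\<not> mat.dependent {S ** H, cubic (S ** H)}"
    using mat.independent_insertI[OF out] S(2) by (simp add: insert_commute)
  have neq: "S ** H \<noteq> cubic (S ** H)" using out mat.span_base by fastforce
  have sub: "{S ** H, cubic (S ** H)} \<subseteq> ?U"
    using S(1) cubic_symmetric[OF H S(1)] matrix_inv_right[OF H(2)]
    by (simp flip: matrix_mul_assoc[of S])
  obtain I where I: "\<not> mat.dependent I" "card I = (CARD('m) + 1) choose 2" "I \<subseteq> ?U"
    using independent_sym_units[OF H(2)] .
  have "CARD('r) < card I" using r I(2) by simp
  then obtain f :: "'r \<Rightarrow> _" and i where f: "f i = S ** H" "inj f" "range f \<subseteq> ?U"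
      "\<not> mat.dependent (range f)" "cubic (S ** H) \<notin> mat.span (range f)"
    by (rule mat.independent_family_containing[OF ind neq sub I(1,3)])
  have "($) (\<chi> i. f i) = f" by (simp add: fun_eq_iff)
  then have "(\<chi> i. f i) \<in> symbol_params H" "cubic ((\<chi> i. f i) $ i) \<notin> mat.span (range (($) (\<chi> i. f i)))"
    unfolding symbol_params_def using f by (simp_all add: image_subset_iff)
  then show ?thesis by (rule that)
qed

section \<open>Detecting linear dependence by a polynomial\<close>

lemma polynomial_function_bounded_linear_image:
  fixes f :: "'a::real_normed_vector \<Rightarrow> 'b::real_normed_vector"
    and h :: "'b \<Rightarrow> 'c::real_normed_vector"
  assumes "bounded_linear h" "polynomial_function f"
  shows "polynomial_function (\<lambda>x. h (f x))"
  unfolding polynomial_function_def o_def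
proof (intro allI impI)
  fix g :: "'c \<Rightarrow> real" assume "bounded_linear g"
  then have "bounded_linear (\<lambda>y. g (h y))" using assms(1) by (rule bounded_linear_compose)
  then show "real_polynomial_function (\<lambda>x. g (h (f x)))"
    using assms(2) unfolding polynomial_function_def o_def by blast
qed

text \<open>
  Polynomial functions with vector values are multiplied by real-valued ones only, so a complex
  product is written as \<open>Re f \<cdot> g + Im f \<cdot> \<i> g\<close>.
\<close>

lemma polynomial_function_complex_mult:
  fixes f g :: "'a::real_normed_vector \<Rightarrow> complex"
  assumes "polynomial_function f" "polynomial_function g"
  shows "polynomial_function (\<lambda>x. f x * g x)"
proof -
  have "polynomial_function (\<lambda>x. Re (f x))" "polynomial_function (\<lambda>x. Im (f x))"
    using assms(1) by (auto intro: polynomial_function_bounded_linear_image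
        bounded_linear_Re bounded_linear_Im)
  then have "polynomial_function (\<lambda>x. Re (f x) *\<^sub>R g x + Im (f x) *\<^sub>R (\<i> * g x))"
    using assms(2) by (intro polynomial_function_add polynomial_function_mult
        polynomial_function_bounded_linear_image[OF bounded_linear_mult_right])
  moreover have "Re (f x) *\<^sub>R g x + Im (f x) *\<^sub>R (\<i> * g x) = f x * g x" for x
    by (simp add: complex_eq_iff)
  ultimately show ?thesis by simp
qed

lemma polynomial_function_complex_prod:
  fixes f :: "'i \<Rightarrow> 'a::real_normed_vector \<Rightarrow> complex"
  assumes "\<And>i. i \<in> I \<Longrightarrow> polynomial_function (f i)"
  shows "polynomial_function (\<lambda>x. \<Prod>i\<in>I. f i x)"
  using assms
  by (induction I rule: infinite_finite_induct) (auto intro: polynomial_function_complex_mult)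

lemma polynomial_function_det:
  fixes M :: "'a::real_normed_vector \<Rightarrow> complex^'n^'n"
  assumes "\<And>i j. polynomial_function (\<lambda>x. M x $ i $ j)"
  shows "polynomial_function (\<lambda>x. det (M x))"
  unfolding det_def
  by (intro polynomial_function_sum polynomial_function_complex_mult
      polynomial_function_complex_prod assms polynomial_function_const)
    (simp add: finite_permutations)

lemma polynomial_function_matrix_mult:
  fixes A B :: "'a::real_normed_vector \<Rightarrow> complex^'n^'n"
  assumes "\<And>i j. polynomial_function (\<lambda>x. A x $ i $ j)" "\<And>i j. polynomial_function (\<lambda>x. B x $ i $ j)"
  shows "polynomial_function (\<lambda>x. (A x ** B x) $ i $ j)"
  unfolding matrix_matrix_mult_def
  by (auto intro!: polynomial_function_sum polynomial_function_complex_mult assms)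

lemma linear_matrix_expansion:
  fixes \<Phi> :: "complex^'m^'m \<Rightarrow> complex^'n"
  assumes "Vector_Spaces.linear mat_scale (*s) \<Phi>"
  shows "\<Phi> A = (\<Sum>i\<in>UNIV. \<Sum>j\<in>UNIV. A $ i $ j *s \<Phi> (axis i (axis j 1)))"
proof -
  interpret MV: vector_space_pair "mat_scale :: complex \<Rightarrow> complex^'m^'m \<Rightarrow> _"
    "(*s) :: complex \<Rightarrow> complex^'n \<Rightarrow> _" ..
  have "A = (\<Sum>i\<in>UNIV. \<Sum>j\<in>UNIV. mat_scale (A $ i $ j) (axis i (axis j 1)))"
  proof -
    have "(\<Sum>i\<in>UNIV. \<Sum>j\<in>UNIV. mat_scale (A $ i $ j) (axis i (axis j 1))) $ k $ l = A $ k $ l" for k l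
    proof -
      have "(\<Sum>i\<in>UNIV. \<Sum>j\<in>UNIV. mat_scale (A $ i $ j) (axis i (axis j 1))) $ k $ l
        = (\<Sum>i\<in>UNIV. \<Sum>j\<in>UNIV. if i = k then (if j = l then A $ i $ j else 0) else 0)"
        unfolding sum_component by (intro sum.cong) (auto simp: mat_scale_def axis_def)
      also have "\<dots> = (\<Sum>i\<in>UNIV. if i = k then (\<Sum>j\<in>UNIV. if j = l then A $ i $ j else 0) else 0)"
        by (intro sum.cong) auto
      also have "\<dots> = A $ k $ l" by simp
      finally show ?thesis .
    qed
    then show ?thesis by (simp add: vec_eq_iff)
  qed
  from arg_cong[where f=\<Phi>, OF this] show ?thesis
    by (simp only: MV.linear_sum[OF assms] MV.linear_scale[OF assms])
qed

lemma polynomial_function_linear_image: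
  fixes \<Phi> :: "complex^'m^'m \<Rightarrow> complex^'n" and M :: "'a::real_normed_vector \<Rightarrow> complex^'m^'m"
  assumes "Vector_Spaces.linear mat_scale (*s) \<Phi>" "\<And>i j. polynomial_function (\<lambda>x. M x $ i $ j)"
  shows "polynomial_function (\<lambda>x. \<Phi> (M x) $ k)"
  by (subst linear_matrix_expansion[OF assms(1)])
    (auto intro!: polynomial_function_sum polynomial_function_complex_mult assms(2))

text \<open>
  This map is chosen once, for a reference tuple, and plays the part of one nonvanishing minor
  of the \<open>(r+1) \<times> m\<^sup>2\<close> matrix of entries.
\<close>

lemma ex_dual_map:
  fixes C :: "complex^'m^'m^'r"
  assumes C: "inj (($) C)" "\<not> mat.dependent (range (($) C))" and T: "T \<notin> mat.span (range (($) C))"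
  obtains \<Phi> :: "complex^'m^'m \<Rightarrow> complex^'r option"
  where "Vector_Spaces.linear mat_scale (*s) \<Phi>" "\<And>i. \<Phi> (C $ i) = axis (Some i) 1"
    "\<Phi> T = axis None 1"
proof -
  interpret MV: vector_space_pair "mat_scale :: complex \<Rightarrow> complex^'m^'m \<Rightarrow> _"
    "(*s) :: complex \<Rightarrow> complex^'r option \<Rightarrow> _" ..
  define f :: "complex^'m^'m \<Rightarrow> complex^'r option"
    where "f A = (if A = T then axis None 1 else axis (Some (inv (($) C) A)) 1)" for A
  from MV.linear_independent_extend[OF mat.independent_insertI[OF T C(2)], of f] obtain \<Phi> where \<Phi>: "Vector_Spaces.linear mat_scale (*s) \<Phi>"
    "\<forall>A\<in>insert T (range (($) C)). \<Phi> A = f A"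
    by (elim exE conjE)
  have "C $ i \<noteq> T" for i using T mat.span_base[of "C $ i" "range (($) C)"] by auto
  then show ?thesis
    using \<Phi> C(1) by (intro that[of \<Phi>]) (auto simp: f_def)
qed

definition bordered :: "'a^'n^'r::finite \<Rightarrow> 'a^'n \<Rightarrow> 'a^'n^('r option)" where
  "bordered v t = (\<chi> k. case k of None \<Rightarrow> t | Some i \<Rightarrow> v $ i)"

text \<open>
  A linear dependence of \<open>T\<close> on the \<open>C\<^sub>i\<close> passes to the images under \<open>\<Phi>\<close>, so the row \<open>None\<close> can be
  cleared by row operations.
\<close>

lemma det_bordered_eq_0:
  fixes C :: "complex^'m^'m^'r" and \<Phi> :: "complex^'m^'m \<Rightarrow> complex^('r option)"
  assumes \<Phi>: "Vector_Spaces.linear mat_scale (*s) \<Phi>" and T: "T \<in> mat.span (range (($) C))"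
  shows "det (bordered (\<chi> i. \<Phi> (C $ i)) (\<Phi> T)) = 0"
proof -
  interpret MV: vector_space_pair "mat_scale :: complex \<Rightarrow> complex^'m^'m \<Rightarrow> _"
    "(*s) :: complex \<Rightarrow> complex^'r option \<Rightarrow> _" ..
  let ?M = "bordered (\<chi> i. \<Phi> (C $ i)) (\<Phi> T)"
  have rows: "row None ?M = \<Phi> T" "row (Some i) ?M = \<Phi> (C $ i)" for i
    by (simp_all add: row_def bordered_def)
  have "\<Phi> T \<in> vec.span (\<Phi> ` range (($) C))"
    using T MV.linear_span_image[OF \<Phi>, of "range (($) C)"] by blast
  also have "\<Phi> ` range (($) C) = (\<lambda>i. row (Some i) ?M) ` UNIV"
    by (simp add: rows image_image)
  also have "\<dots> = {row j ?M |j. j \<noteq> None}"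
    by (auto simp: not_None_eq)
  finally have "- row None ?M \<in> vec.span {row j ?M |j. j \<noteq> None}"
    unfolding rows by (rule vec.span_neg)
  from det_row_span[OF this] show ?thesis
    unfolding right_minus det_row_0 by (rule sym)
qed

section \<open>Genericity\<close>

theorem lemma7p5:
  fixes n r :: nat
  assumes "CARD('m::finite) = n - r" and "CARD('r::finite) = r"
    and "(n - r + 1) choose 2 > r"
  shows "generic_symbols TYPE('m) TYPE('r)
    (nonregular_symbols n r :: 'v::ab_group_add cr_symbol set)"
  unfolding generic_symbols_def
proof (intro allI impI, elim conjE)
  fix H :: "complex^'m^'m"
  assume H: "hermitian H" "invertible H"
  have "0 < CARD('m)" by simp
  then have n: "CARD('m) + CARD('r) = n" using assms(1,2) by linarith
  have "CARD('r) < (CARD('m) + 1) choose 2" using assms by simp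
  then obtain C\<^sub>0 :: "complex^'m^'m^'r" and i where C\<^sub>0: "C\<^sub>0 \<in> symbol_params H"
    and out: "cubic (C\<^sub>0 $ i) \<notin> mat.span (range (($) C\<^sub>0))"
    using ex_params_cubic_outside_span[OF H] by blast
  obtain \<Phi> :: "complex^'m^'m \<Rightarrow> complex^('r option)"
    where lin: "Vector_Spaces.linear mat_scale (*s) \<Phi>"
      and \<Phi>: "\<And>j. \<Phi> (C\<^sub>0 $ j) = axis (Some j) 1" "\<Phi> (cubic (C\<^sub>0 $ i)) = axis None 1"
    using ex_dual_map[OF _ _ out] C\<^sub>0 unfolding symbol_params_def by blast
  define M where "M C = bordered (\<chi> j. \<Phi> (C $ j)) (\<Phi> (cubic (C $ i)))" for C :: "complex^'m^'m^'r"
  define p where "p C = Re (det (M C))" for C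
  have coord: "polynomial_function (\<lambda>C :: complex^'m^'m^'r. C $ j $ k $ l)" for j k l
    by (intro polynomial_function_bounded_linear bounded_linear_vec_nth
        bounded_linear_compose[OF bounded_linear_vec_nth])
  then have "polynomial_function (\<lambda>C :: complex^'m^'m^'r. map_matrix cnj (C $ j) $ k $ l)" for j k l
    by (simp add: polynomial_function_bounded_linear_image[OF bounded_linear_cnj])
  with coord have "polynomial_function (\<lambda>C :: complex^'m^'m^'r. cubic (C $ j) $ k $ l)" for j k l
    unfolding cubic_def by (intro polynomial_function_matrix_mult)
  with coord have "polynomial_function (\<lambda>C. M C $ k $ l)" for k l
    by (cases k) (auto simp: M_def bordered_def intro!: polynomial_function_linear_image[OF lin])
  then have "real_polynomial_function p"
    unfolding p_def real_polynomial_function_eq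
    by (intro polynomial_function_bounded_linear_image[OF bounded_linear_Re] polynomial_function_det)
  then have "real_algebraic_subset (symbol_params H) {C \<in> symbol_params H. p C = 0}"
    unfolding real_algebraic_subset_def by (intro exI[of _ "{p}"]) simp
  moreover have "{C \<in> symbol_params H. p C = 0} \<noteq> symbol_params H"
  proof -
    have "M C\<^sub>0 $ k = axis k 1" for k by (cases k) (simp_all add: M_def bordered_def \<Phi>)
    then have "M C\<^sub>0 = mat 1" by (auto simp: vec_eq_iff mat_def axis_def)
    then have "p C\<^sub>0 = 1" by (simp add: p_def)
    then show ?thesis using C\<^sub>0 by force
  qed
  moreover have "s \<in> nonregular_symbols n r"
    if s: "s \<in> CR_symbols (CARD('m) + CARD('r)) CARD('r)" "represented_by s H C"
      and C: "C \<in> symbol_params H - {C \<in> symbol_params H. p C = 0}"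
    for C and s :: "'v cr_symbol"
  proof -
    have "\<not> regular_symbol s"
    proof
      assume "regular_symbol s"
      from regular_symbol_cubic_in_span[OF s this]
      have "cubic (C $ i) \<in> mat.span (range (($) C))"
        by (simp add: mat.span_base)
      then have "p C = 0" by (simp add: p_def M_def det_bordered_eq_0[OF lin])
      with C show False by simp
    qed
    then show ?thesis using s(1)[unfolded n] by (simp add: nonregular_symbols_def assms(2))
  qed
  ultimately show "\<exists>A :: (complex^'m^'m^'r) set.
      real_algebraic_subset (symbol_params H) A \<and> A \<noteq> symbol_params H \<and>
      (\<forall>C \<in> symbol_params H - A.
         \<forall>s \<in> CR_symbols (CARD('m) + CARD('r)) CARD('r).
           represented_by s H C \<longrightarrow> s \<in> (nonregular_symbols n r :: 'v cr_symbol set))"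
    by (intro exI[of _ "{C \<in> symbol_params H. p C = 0}"] conjI ballI impI)
qed

end
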